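(* For all integers $k\ge 3$ and $t\ge 1$, $C_k\le C_{t(k-2)+2}$. In particular, for every $t\ge 2$, $C_4\le C_{2t}$.
   Context: All graphs are finite and simple, considered up to isomorphism. An edge-colored graph is a pair $(G,c)$ with $c\colon E(G)\to\mathbb{N}$ an arbitrary map (not necessarily proper); it is colored in $t$ or more colors if $|c(E(G))|\ge t$. A subgraph (not necessarily induced) is rainbow if its edges receive pairwise distinct colors. $(G,c)$ is rainbow $H$-free if $G$ contains no rainbow subgraph isomorphic to $H$. For graphs $H_1,H_2$, write $H_1\le H_2$ if there is a positive integer $s$ such that every rainbow $H_1$-free edge-colored complete graph colored in $s$ or more colors is rainbow $H_2$-free. $C_k$ is the cycle on $k$ vertices. *)

theory Defs
  imports Main
begin

record 'a graph =
  verts :: "'a set"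
  edges :: "'a set set"

definition simple_graph :: "'a graph \<Rightarrow> bool" where
  "simple_graph G \<longleftrightarrow> finite (verts G) \<and> edges G \<subseteq> {e. e \<subseteq> verts G \<and> card e = 2}"

definition complete_graph :: "'a set \<Rightarrow> 'a graph" where
  "complete_graph V = \<lparr>verts = V, edges = {e. e \<subseteq> V \<and> card e = 2}\<rparr>"

(* Only meaningful for k >= 3; for smaller k the edge set degenerates. *)
definition cycle_graph :: "nat \<Rightarrow> nat graph" where
  "cycle_graph k = \<lparr>verts = {..<k}, edges = {{i, Suc i mod k} | i. i < k}\<rparr>"

definition subgraph :: "'a graph \<Rightarrow> 'a graph \<Rightarrow> bool" where
  "subgraph F G \<longleftrightarrow> simple_graph F \<and> verts F \<subseteq> verts G \<and> edges F \<subseteq> edges G"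

definition graph_iso :: "'a graph \<Rightarrow> 'b graph \<Rightarrow> bool" where
  "graph_iso G H \<longleftrightarrow> (\<exists>f. bij_betw f (verts G) (verts H) \<and>
     (\<forall>u\<in>verts G. \<forall>v\<in>verts G. {u, v} \<in> edges G \<longleftrightarrow> {f u, f v} \<in> edges H))"

(* A coloring is a total function on vertex sets; only its values on edges matter. *)
definition rainbow :: "('a set \<Rightarrow> nat) \<Rightarrow> 'a graph \<Rightarrow> bool" where
  "rainbow c F \<longleftrightarrow> inj_on c (edges F)"

definition rainbow_free :: "'a graph \<Rightarrow> ('a set \<Rightarrow> nat) \<Rightarrow> 'b graph \<Rightarrow> bool" where
  "rainbow_free G c H \<longleftrightarrow> \<not> (\<exists>F. subgraph F G \<and> rainbow c F \<and> graph_iso F H)"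

(* The host complete graphs range over all finite vertex sets of naturals, which covers
   every finite complete graph up to isomorphism. *)
definition rainbow_le :: "'a graph \<Rightarrow> 'b graph \<Rightarrow> bool" where
  "rainbow_le H1 H2 \<longleftrightarrow>
     (\<exists>s::nat. s \<ge> 1 \<and>
       (\<forall>(V::nat set) c.
          finite V \<and> card (c ` edges (complete_graph V)) \<ge> s \<and>
          rainbow_free (complete_graph V) c H1 \<longrightarrow>
          rainbow_free (complete_graph V) c H2))"

end

theory Submission
  imports Defs
begin

text \<open>Cut a rainbow cycle of length \<open>t(k-2)+2\<close> by a chord into a \<open>k\<close>-cycle and a cycle of length
  \<open>(t-1)(k-2)+2\<close>. The colour of the chord occurs on at most one side of the original cycle, so
  one of the two shorter cycles is rainbow, and induction on \<open>t\<close> produces a rainbow \<open>C\<^sub>k\<close>.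
  The number of colours plays no role, so the threshold \<open>s = 1\<close> suffices.\<close>

text \<open>In a complete host an injective list of \<open>n\<close> vertices determines a cycle for
  \<open>n \<ge> 3\<close>. Encoding the cycle this way replaces subgraphs and isomorphisms by index
  arithmetic modulo \<open>n\<close>.\<close>

definition has_rainbow_cycle :: "'a set \<Rightarrow> ('a set \<Rightarrow> nat) \<Rightarrow> nat \<Rightarrow> bool" where
  "has_rainbow_cycle V c n \<longleftrightarrow>
     (\<exists>f. inj_on f {..<n} \<and> f ` {..<n} \<subseteq> V \<and> inj_on (\<lambda>i. c {f i, f (Suc i mod n)}) {..<n})"

text \<open>Two distinct indices with the same edge would be each other's successors, which forces
  \<open>n = 2\<close>. Hence edges can be indexed by their first endpoint.\<close>

lemma inj_on_cycle_edge:
  assumes "n \<ge> 3"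
  shows "inj_on (\<lambda>i. {i, Suc i mod n}) {..<n}"
  using assms by (auto simp: inj_on_def doubleton_eq_iff mod_Suc split: if_splits)

lemma has_rainbow_cycle_if_subgraph:
  assumes n: "n \<ge> 3"
    and F: "subgraph F (complete_graph V)" "rainbow c F" "graph_iso F (cycle_graph n)"
  shows "has_rainbow_cycle V c n"
proof -
  obtain g where g: "bij_betw g (verts F) {..<n}"
    and ge: "\<And>u v. u \<in> verts F \<Longrightarrow> v \<in> verts F \<Longrightarrow>
      {u, v} \<in> edges F \<longleftrightarrow> {g u, g v} \<in> edges (cycle_graph n)"
    using F(3) unfolding graph_iso_def by (auto simp: cycle_graph_def)
  define f where "f = inv_into (verts F) g"
  have f: "bij_betw f {..<n} (verts F)"
    unfolding f_def by (rule bij_betw_inv_into[OF g])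
  have gf: "g (f i) = i" if "i < n" for i
    using that bij_betw_inv_into_right[OF g] by (simp add: f_def)
  have fv: "f i \<in> verts F" if "i < n" for i
    using that f by (auto simp: bij_betw_def)
  have lt: "Suc i mod n < n" for i using n by simp
  have edge: "{f i, f (Suc i mod n)} \<in> edges F" if "i < n" for i
    using that ge[OF fv[OF that] fv[OF lt]] by (auto simp: gf lt cycle_graph_def)
  have f_inj: "inj_on f {..<n}" using f by (simp add: bij_betw_def)
  have "inj_on (\<lambda>i. c {f i, f (Suc i mod n)}) {..<n}"
  proof (rule inj_onI)
    fix i j assume i: "i \<in> {..<n}" and j: "j \<in> {..<n}"
      and "c {f i, f (Suc i mod n)} = c {f j, f (Suc j mod n)}"
    \<comment> \<open>Rainbowness identifies the two edges of \<open>F\<close>; writing them as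
      images lets injectivity of \<open>f\<close> pull the equality back to index pairs.\<close>
    then have "f ` {i, Suc i mod n} = f ` {j, Suc j mod n}"
      using F(2) edge unfolding rainbow_def by (auto dest: inj_onD)
    then have "{i, Suc i mod n} = {j, Suc j mod n}"
      by (subst (asm) inj_on_image_eq_iff[OF f_inj]) (use i j lt in auto)
    then show "i = j"
      using inj_onD[OF inj_on_cycle_edge[OF n]] i j by simp
  qed
  moreover have "verts F \<subseteq> V"
    using F(1) by (simp add: subgraph_def complete_graph_def)
  ultimately show ?thesis
    unfolding has_rainbow_cycle_def using f by (auto simp: bij_betw_def)
qed

lemma subgraph_if_has_rainbow_cycle:
  assumes n: "n \<ge> 3" and "has_rainbow_cycle V c n"
  shows "\<exists>F. subgraph F (complete_graph V) \<and> rainbow c F \<and> graph_iso F (cycle_graph n)"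
proof -
  obtain f where f: "inj_on f {..<n}" and fV: "f ` {..<n} \<subseteq> V"
    and fc: "inj_on (\<lambda>i. c {f i, f (Suc i mod n)}) {..<n}"
    using assms(2) unfolding has_rainbow_cycle_def by blast
  define F where
    "F = \<lparr>verts = f ` {..<n}, edges = (\<lambda>i. {f i, f (Suc i mod n)}) ` {..<n}\<rparr>"
  have lt: "Suc i mod n < n" for i using n by simp
  have ne: "f i \<noteq> f (Suc i mod n)" if "i < n" for i
    using inj_onD[OF f, of i "Suc i mod n"] that n lt
    by (auto simp: mod_Suc split: if_splits)
  have edges: "e \<subseteq> f ` {..<n} \<and> card e = 2" if "e \<in> edges F" for e
    using that ne lt by (auto simp: F_def)
  have "subgraph F (complete_graph V)"
    using edges fV by (fastforce simp: subgraph_def simple_graph_def complete_graph_def F_def)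
  moreover have "rainbow c F"
    using inj_on_imageI[of c "\<lambda>i. {f i, f (Suc i mod n)}"] fc
    by (simp add: rainbow_def F_def comp_def)
  moreover have "graph_iso F (cycle_graph n)"
    unfolding graph_iso_def
  proof (intro exI conjI ballI)
    show "bij_betw (inv_into {..<n} f) (verts F) (verts (cycle_graph n))"
      using f by (simp add: F_def cycle_graph_def inj_on_imp_bij_betw bij_betw_inv_into)
  next
    fix u v assume "u \<in> verts F" "v \<in> verts F"
    then obtain a b where ab: "a < n" "b < n" "u = f a" "v = f b"
      by (auto simp: F_def)
    have "{f a, f b} = {f i, f (Suc i mod n)} \<longleftrightarrow> {a, b} = {i, Suc i mod n}" if "i < n" for i
      using inj_on_image_eq_iff[OF f, of "{a, b}" "{i, Suc i mod n}"] ab lt that by simp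
    then show "{u, v} \<in> edges F \<longleftrightarrow>
        {inv_into {..<n} f u, inv_into {..<n} f v} \<in> edges (cycle_graph n)"
      using ab f by (auto simp: F_def cycle_graph_def)
  qed
  ultimately show ?thesis by blast
qed

lemma rainbow_free_cycle_iff:
  assumes "n \<ge> 3"
  shows "rainbow_free (complete_graph V) c (cycle_graph n) \<longleftrightarrow> \<not> has_rainbow_cycle V c n"
  unfolding rainbow_free_def
  using has_rainbow_cycle_if_subgraph subgraph_if_has_rainbow_cycle assms by blast

text \<open>The two cycles cut off by a chord share its two ends, so their lengths add up to that of
  the long cycle plus 2.\<close>

lemma rainbow_cycle_chord:
  assumes k: "k \<ge> 3" and m: "m \<ge> 3" and "has_rainbow_cycle V c (m + k - 2)"
  shows "has_rainbow_cycle V c k \<or> has_rainbow_cycle V c m"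
proof -
  define n where "n = m + k - 2"
  obtain f where f: "inj_on f {..<n}" and fV: "f ` {..<n} \<subseteq> V"
    and fc: "inj_on (\<lambda>i. c {f i, f (Suc i mod n)}) {..<n}"
    using assms(3) unfolding has_rainbow_cycle_def n_def by blast
  define e where "e i = c {f i, f (Suc i mod n)}" for i
  \<comment> \<open>The chord joins positions \<open>0\<close> and \<open>k - 1\<close>: edges with
    index below \<open>k - 1\<close> lie on the side of the \<open>k\<close>-cycle, the others on
    the side of the \<open>m\<close>-cycle.\<close>
  define d where "d = c {f 0, f (k - 1)}"
  have e_inj: "e i = e j \<longleftrightarrow> i = j" if "i < n" "j < n" for i j
    using fc that by (auto simp: e_def inj_on_def)
  have kn: "k < n" using k m by (simp add: n_def)
  show ?thesis
  proof (cases "\<exists>i<k - 1. e i = d")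
    case False
    \<comment> \<open>The chord is the closing edge of the \<open>k\<close>-cycle, at index
      \<open>k - 1\<close>.\<close>
    have col: "c {f i, f (Suc i mod k)} = (if i = k - 1 then d else e i)" if "i < k" for i
      using that k kn by (auto simp: e_def d_def mod_Suc insert_commute)
    have "e i \<noteq> d" if "i < k" "i \<noteq> k - 1" for i
      using False that by auto
    then have "inj_on (\<lambda>i. if i = k - 1 then d else e i) {..<k}"
      using kn by (force simp: inj_on_def e_inj)
    then have "inj_on (\<lambda>i. c {f i, f (Suc i mod k)}) {..<k}"
      by (subst inj_on_cong[where g = "\<lambda>i. if i = k - 1 then d else e i"]) (simp_all add: col)
    moreover have "inj_on f {..<k}" "f ` {..<k} \<subseteq> V"
      using f fV kn by (auto intro: inj_on_subset)
    ultimately show ?thesis unfolding has_rainbow_cycle_def by blast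
  next
    case True
    then obtain p where p: "p < k - 1" "e p = d" by blast
    \<comment> \<open>The other cycle starts at \<open>f 0\<close>, skips positions \<open>1\<close>
      to \<open>k - 2\<close>, and runs from \<open>k - 1\<close> to \<open>n - 1\<close>; its edge
      \<open>0\<close> is the chord.\<close>
    define h where "h i = f (if i = 0 then 0 else i + k - 2)" for i
    have col: "c {h i, h (Suc i mod m)} = (if i = 0 then d else e (i + k - 2))" if "i < m" for i
    proof (cases "Suc i = m")
      case True
      \<comment> \<open>At the last index both cycles wrap around to \<open>f 0\<close>
        together.\<close>
      then have "Suc (i + k - 2) = n" using k m by (simp add: n_def)
      then show ?thesis using True m by (simp add: e_def h_def)
    next
      case False
      then have "Suc (i + k - 2) mod n = Suc i + k - 2" "Suc i mod m = Suc i"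
        using that k by (simp_all add: n_def)
      then show ?thesis using k by (simp add: e_def h_def d_def)
    qed
    \<comment> \<open>The colour \<open>d\<close> already occurs at \<open>p < k - 1\<close>, and
      these indices are at least \<open>k - 1\<close>.\<close>
    have e_ne_d: "e (i + k - 2) \<noteq> d" if "0 < i" "i < m" for i
      using e_inj[of "i + k - 2" p] p that kn k by (auto simp: n_def)
    have e_shift: "e (i + k - 2) = e (j + k - 2) \<longleftrightarrow> i = j" if "i < m" "j < m" for i j
      using e_inj[of "i + k - 2" "j + k - 2"] that k by (auto simp: n_def)
    have "inj_on (\<lambda>i. if i = 0 then d else e (i + k - 2)) {..<m}"
      by (intro inj_onI) (auto simp: e_shift e_ne_d e_ne_d[symmetric] split: if_splits)
    then have "inj_on (\<lambda>i. c {h i, h (Suc i mod m)}) {..<m}"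
      by (subst inj_on_cong[where g = "\<lambda>i. if i = 0 then d else e (i + k - 2)"]) (simp_all add: col)
    moreover have "inj_on h {..<m}"
    proof (rule inj_onI)
      fix i j assume ij: "i \<in> {..<m}" "j \<in> {..<m}" and "h i = h j"
      then have "(if i = 0 then 0 else i + k - 2) = (if j = 0 then 0 else j + k - 2)"
        using k kn by (intro inj_onD[OF f]) (auto simp: h_def n_def)
      then show "i = j" using k by (auto split: if_splits)
    qed
    moreover have "h ` {..<m} \<subseteq> V"
      using fV k kn by (force simp: h_def n_def)
    ultimately show ?thesis unfolding has_rainbow_cycle_def by blast
  qed
qed

text \<open>Each chord either gives a rainbow \<open>k\<close>-cycle at once or shortens the cycle
  by \<open>k - 2\<close>. Writing \<open>Suc t\<close> makes length \<open>k\<close> the base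
  case.\<close>

lemma has_rainbow_cycle_reduce:
  assumes k: "k \<ge> 3"
  shows "has_rainbow_cycle V c (Suc t * (k - 2) + 2) \<Longrightarrow> has_rainbow_cycle V c k"
proof (induction t)
  case 0
  moreover have "Suc 0 * (k - 2) + 2 = k" using k by simp
  ultimately show ?case by metis
next
  case (Suc t)
  have "Suc (Suc t) * (k - 2) + 2 = (Suc t * (k - 2) + 2) + k - 2" "Suc t * (k - 2) + 2 \<ge> 3"
    using k by simp_all
  with Suc k show ?case
    using rainbow_cycle_chord[of k "Suc t * (k - 2) + 2" V c] by metis
qed

lemma rainbow_le_cycle_graph:
  assumes k: "k \<ge> 3" and t: "t \<ge> 1"
  shows "rainbow_le (cycle_graph k) (cycle_graph (t * (k - 2) + 2))"
proof -
  obtain t' where t': "t = Suc t'" using t by (cases t) auto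
  have "t * (k - 2) + 2 \<ge> 3" using k t' by simp
  then show ?thesis
    unfolding rainbow_le_def
    using has_rainbow_cycle_reduce[OF k, of _ _ t'] k
    by (intro exI[of _ 1]) (auto simp: rainbow_free_cycle_iff t')
qed

theorem theorem7:
  shows "(\<forall>k t :: nat. k \<ge> 3 \<and> t \<ge> 1 \<longrightarrow>
            rainbow_le (cycle_graph k) (cycle_graph (t * (k - 2) + 2))) \<and>
         (\<forall>t :: nat. t \<ge> 2 \<longrightarrow> rainbow_le (cycle_graph 4) (cycle_graph (2 * t)))"
proof (intro conjI allI impI)
  fix k t :: nat assume "k \<ge> 3 \<and> t \<ge> 1"
  then show "rainbow_le (cycle_graph k) (cycle_graph (t * (k - 2) + 2))"
    by (blast intro: rainbow_le_cycle_graph)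
next
  fix t :: nat assume t: "t \<ge> 2"
  \<comment> \<open>Even lengths are the case \<open>k = 4\<close> with parameter
    \<open>t - 1\<close>, which is positive as \<open>t \<ge> 2\<close>.\<close>
  then have "(t - 1) * (4 - 2) + 2 = 2 * t" by simp
  with rainbow_le_cycle_graph[of 4 "t - 1"] t
  show "rainbow_le (cycle_graph 4) (cycle_graph (2 * t))" by simp
qed

end
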